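(* Let $V$ be a finite-dimensional vector space over $\mathbb{F}_q$, let $\mathcal{F}=\{\langle f_1\rangle,\dots,\langle f_\nu\rangle\}$ be a projective point family in $V$, and let $\varphi:\mathbb{F}_q^\nu\to V$ be a parent function of $\mathcal{F}$. Endow $\mathbb{F}_q^\nu$ with the Hamming weight. Then $\operatorname{wt}_{\mathcal{F}}=\operatorname{wt}_{\mathrm{quot},\varphi}$, and the parent code $\ker(\varphi)$ has minimum Hamming distance $d_H(\ker\varphi)=\min_{x,y\in\ker\varphi,\,x\neq y}d_H(x,y)\ge 3$.
   Context: A projective point family is a set of pairwise linearly independent nonzero vectors (equivalently, distinct $1$-dimensional subspaces) $\mathcal{F}$ in $V$, with projective weight $\operatorname{wt}_{\mathcal{F}}(x)=\min(\{|I|:I\subseteq\mathcal{F},\ x\in\langle I\rangle\}\cup\{\infty\})$. A parent function of $\mathcal{F}$ is a linear map $\varphi:\mathbb{F}_q^\nu\to V$ such that $\{\langle\varphi(e_i)\rangle: i=1,\dots,\nu\}=\mathcal{F}$, where $e_i$ are the standard basis vectors; $\ker\varphi$ is a parent code. For a linear map $\psi:(X,\operatorname{wt}_X)\to Y$, $\operatorname{wt}_{\mathrm{quot},\psi}(y)=\min\{\operatorname{wt}_X(w):w\in\psi^{-1}(y)\}$, and $\infty$ if $\psi^{-1}(y)=\emptyset$. *)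

theory Defs
  imports "HOL-Analysis.Analysis" "HOL-Library.Extended_Nat"
begin

text \<open>The ambient space V is a type 'v with a scalar multiplication
  smul over a finite field 'a (= F_q). F_q^nu is 'a^'n, 'n a finite index type
  with CARD('n) = nu.\<close>

text \<open>Projective point family: a set of one-dimensional subspaces of V.\<close>
definition proj_point_family :: "('a::field \<Rightarrow> 'v::ab_group_add \<Rightarrow> 'v) \<Rightarrow> 'v set set \<Rightarrow> bool" where
  "proj_point_family smul F \<longleftrightarrow> (\<forall>P\<in>F. \<exists>f. f \<noteq> 0 \<and> P = module.span smul {f})"

text \<open>Projective weight: min |I| over I subset F with x in the span of I, or infinity.\<close>
definition proj_weight :: "('a::field \<Rightarrow> 'v::ab_group_add \<Rightarrow> 'v) \<Rightarrow> 'v set set \<Rightarrow> 'v \<Rightarrow> enat" where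
  "proj_weight smul F x =
     Inf {enat (card I) | I. I \<subseteq> F \<and> finite I \<and> x \<in> module.span smul (\<Union>I)}"

text \<open>Parent function: a linear map with {<phi(e_i)>} = F.\<close>
definition parent_function :: "('a::field \<Rightarrow> 'v::ab_group_add \<Rightarrow> 'v) \<Rightarrow> 'v set set
    \<Rightarrow> ('a^'n::finite \<Rightarrow> 'v) \<Rightarrow> bool" where
  "parent_function smul F \<phi> \<longleftrightarrow>
     Vector_Spaces.linear ((*s) :: 'a \<Rightarrow> 'a^'n \<Rightarrow> 'a^'n) smul \<phi> \<and>
     (\<lambda>i. module.span smul {\<phi> (axis i 1)}) ` UNIV = F"

definition hamming_weight :: "'a::zero^'n::finite \<Rightarrow> enat" where
  "hamming_weight x = enat (card {i. x $ i \<noteq> 0})"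

definition hamming_dist :: "'a^'n::finite \<Rightarrow> 'a^'n \<Rightarrow> nat" where
  "hamming_dist x y = card {i. x $ i \<noteq> y $ i}"

text \<open>Quotient weight: min of wt over the preimage, infinity if the preimage is empty
  (Inf of the empty set of enat is infinity).\<close>
definition wt_quot :: "('x \<Rightarrow> enat) \<Rightarrow> ('x \<Rightarrow> 'y) \<Rightarrow> 'y \<Rightarrow> enat" where
  "wt_quot wt \<psi> y = (INF w \<in> \<psi> -` {y}. wt w)"

end

theory Submission
  imports Defs
begin

(* For a linear phi, the span of the lines <phi(e_i)>, i in S, is exactly the image under phi
   of the vectors supported in S; hence both weights minimise the same cardinalities.
   Two codewords at distance 1 or 2 would give a nonzero kernel vector supported on one or two
   coordinates: one coordinate forces phi(e_i) = 0, two force <phi(e_i)> = <phi(e_j)>, and both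
   contradict F consisting of nu distinct points. *)

lemma vec_eq_sum_axis:
  fixes w :: "'a::ring_1^'n::finite"
  assumes "{i. w $ i \<noteq> 0} \<subseteq> S"
  shows "w = (\<Sum>i\<in>S. w $ i *s axis i 1)"
proof -
  have "w $ i = 0" if "i \<notin> S" for i
    using assms that by blast
  then have "(\<Sum>i\<in>S. w $ i *s axis i 1) = (\<Sum>i\<in>UNIV. w $ i *s axis i 1)"
    by (intro sum.mono_neutral_left) auto
  then show ?thesis by (simp add: basis_expansion)
qed

lemma vec_span_axis_eq:
  "vec.span ((\<lambda>i. axis i 1) ` S) = {w :: 'a::field^'n::finite. {i. w $ i \<noteq> 0} \<subseteq> S}"
  (is "?L = ?R")
proof
  have subspace: "vec.subspace ?R"
    unfolding vec.subspace_def by (auto simp: subset_iff) (metis add.right_neutral)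
  show "?L \<subseteq> ?R"
    by (rule vec.span_minimal[OF _ subspace]) (auto simp: axis_def split: if_splits)
next
  show "?R \<subseteq> ?L"
  proof safe
    fix w :: "'a^'n" assume "{i. w $ i \<noteq> 0} \<subseteq> S"
    then have "w = (\<Sum>i\<in>S. w $ i *s axis i 1)" by (rule vec_eq_sum_axis)
    also have "\<dots> \<in> vec.span ((\<lambda>i. axis i 1) ` S)"
      by (intro vec.span_sum vec.span_scale vec.span_base) auto
    finally show "w \<in> vec.span ((\<lambda>i. axis i 1) ` S)" .
  qed
qed

lemma proj_weight_le_card:
  assumes "I \<subseteq> F" "finite I" "x \<in> module.span smul (\<Union>I)"
  shows "proj_weight smul F x \<le> enat (card I)"
  unfolding proj_weight_def using assms by (intro Inf_lower) blast

lemma wt_quot_le: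
  assumes "\<psi> w = y"
  shows "wt_quot wt \<psi> y \<le> wt w"
  unfolding wt_quot_def using assms by (intro INF_lower) simp

(* Inside this context the infix *s denotes the locale's scalar multiplication, so the
   one on 'a^'n is written vector_scalar_mult. *)
context vector_space
begin

lemma span_UN_span_singleton: "span (\<Union>i\<in>S. span {e i}) = span (e ` S)"
proof -
  have "(\<Union>i\<in>S. span {e i}) \<subseteq> span (e ` S)"
    using span_mono[of "{e i}" "e ` S" for i] by auto
  moreover have "e ` S \<subseteq> (\<Union>i\<in>S. span {e i})"
    using span_base by fastforce
  ultimately show ?thesis
    by (metis span_eq span_span span_superset subset_trans)
qed

lemma scale_add_eq_0_imp_span_singleton_eq:
  assumes "a \<noteq> 0" "b \<noteq> 0" "scale a u + scale b v = 0"
  shows "span {u} = span {v}"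
proof -
  have eq: "scale a u = scale (- b) v"
    using assms(3) by (simp add: eq_neg_iff_add_eq_0 scale_minus_left)
  have "u = scale (inverse a) (scale a u)" using assms(1) by simp
  also have "\<dots> = scale (inverse a * - b) v" by (simp only: eq scale_scale)
  finally have u: "u = scale (inverse a * - b) v" .
  have "v = scale (inverse (- b)) (scale (- b) v)" using assms(2) by simp
  also have "\<dots> = scale (inverse (- b) * a) u" by (simp only: eq[symmetric] scale_scale)
  finally have v: "v = scale (inverse (- b) * a) u" .
  have "u \<in> span {v}" by (subst u) (intro span_scale span_base singletonI)
  moreover have "v \<in> span {u}" by (subst v) (intro span_scale span_base singletonI)
  ultimately show ?thesis unfolding span_eq by simp
qed

lemma linear_vec_eq_sum_axis:
  assumes "Vector_Spaces.linear vector_scalar_mult scale \<phi>" and "{i. w $ i \<noteq> 0} \<subseteq> S"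
  shows "\<phi> w = (\<Sum>i\<in>S. scale (w $ i) (\<phi> (axis i 1)))"
proof -
  interpret \<phi>: Vector_Spaces.linear vector_scalar_mult scale \<phi> by (rule assms(1))
  have "\<phi> w = \<phi> (\<Sum>i\<in>S. w $ i *s axis i 1)"
    using vec_eq_sum_axis[OF assms(2)] by simp
  then show ?thesis by (simp add: \<phi>.sum \<phi>.scale)
qed

lemma linear_span_lines_eq_image_support:
  assumes "Vector_Spaces.linear vector_scalar_mult scale \<phi>"
  shows "span (\<Union>i\<in>S. span {\<phi> (axis i 1)}) = \<phi> ` {w. {i. w $ i \<noteq> 0} \<subseteq> S}"
proof -
  interpret \<phi>: Vector_Spaces.linear vector_scalar_mult scale \<phi> by (rule assms)
  have "span (\<Union>i\<in>S. span {\<phi> (axis i 1)}) = span (\<phi> ` (\<lambda>i. axis i 1) ` S)"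
    by (simp add: span_UN_span_singleton image_image)
  also have "\<dots> = \<phi> ` vec.span ((\<lambda>i. axis i 1) ` S)"
    by (rule \<phi>.span_image)
  finally show ?thesis by (simp add: vec_span_axis_eq)
qed

lemma proj_weight_eq_wt_quot:
  assumes "parent_function scale F \<phi>"
  shows "proj_weight scale F x = wt_quot hamming_weight \<phi> x"
proof -
  define line where "line i = span {\<phi> (axis i 1)}" for i
  have lin: "Vector_Spaces.linear vector_scalar_mult scale \<phi>" and F: "range line = F"
    using assms unfolding parent_function_def line_def by auto
  have span_lines: "span (\<Union>(line ` S)) = \<phi> ` {w. {i. w $ i \<noteq> 0} \<subseteq> S}" for S
    unfolding line_def by (rule linear_span_lines_eq_image_support[OF lin])
  show ?thesis
  proof (rule antisym)
    show "proj_weight scale F x \<le> wt_quot hamming_weight \<phi> x"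
      unfolding wt_quot_def
    proof (rule INF_greatest)
      fix w assume "w \<in> \<phi> -` {x}"
      then have "x \<in> span (\<Union>(line ` {i. w $ i \<noteq> 0}))"
        by (auto simp: span_lines)
      then have "proj_weight scale F x \<le> enat (card (line ` {i. w $ i \<noteq> 0}))"
        using F by (intro proj_weight_le_card) auto
      also have "\<dots> \<le> hamming_weight w"
        unfolding hamming_weight_def by (simp add: card_image_le)
      finally show "proj_weight scale F x \<le> hamming_weight w" .
    qed
  next
    show "wt_quot hamming_weight \<phi> x \<le> proj_weight scale F x"
      unfolding proj_weight_def
    proof (rule Inf_greatest, safe)
      fix I assume "I \<subseteq> F" and x: "x \<in> span (\<Union>I)"
      then obtain S where S: "inj_on line S" "I = line ` S"
        using F subset_image_inj[of I line UNIV] by auto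
      with x obtain w where w: "\<phi> w = x" "{i. w $ i \<noteq> 0} \<subseteq> S"
        by (auto simp: span_lines)
      have "wt_quot hamming_weight \<phi> x \<le> hamming_weight w"
        using w(1) by (rule wt_quot_le)
      also have "\<dots> \<le> enat (card S)"
        unfolding hamming_weight_def using w(2) by (simp add: card_mono)
      also have "card S = card I"
        using S by (simp add: card_image)
      finally show "wt_quot hamming_weight \<phi> x \<le> enat (card I)" .
    qed
  qed
qed

lemma parent_function_axis_neq_0:
  assumes "proj_point_family scale F" "parent_function scale F \<phi>"
  shows "\<phi> (axis i 1) \<noteq> 0"
proof
  assume "\<phi> (axis i 1) = 0"
  then have "span {\<phi> (axis i 1)} = {0}" by simp
  moreover obtain f where "f \<noteq> 0" "span {\<phi> (axis i 1)} = span {f}"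
    using assms unfolding proj_point_family_def parent_function_def by blast
  ultimately show False using span_base[of f "{f}"] by auto
qed

lemma parent_function_inj_lines:
  assumes "card F = CARD('n::finite)" "parent_function scale F (\<phi> :: 'a^'n \<Rightarrow> 'b)"
  shows "inj (\<lambda>i. span {\<phi> (axis i 1)})"
proof (rule eq_card_imp_inj_on)
  show "card (range (\<lambda>i. span {\<phi> (axis i 1)})) = card (UNIV :: 'n set)"
    using assms unfolding parent_function_def by simp
qed simp

lemma parent_code_weight_ge_3:
  assumes "proj_point_family scale F" "card F = CARD('n::finite)"
    and "parent_function scale F (\<phi> :: 'a^'n \<Rightarrow> 'b)"
    and "\<phi> d = 0" "d \<noteq> 0"
  shows "3 \<le> card {i. d $ i \<noteq> 0}"
proof (rule ccontr)
  define S where "S = {i. d $ i \<noteq> 0}"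
  have lin: "Vector_Spaces.linear vector_scalar_mult scale \<phi>"
    using assms(3) unfolding parent_function_def by simp
  have "card S \<noteq> 0" using assms(5) unfolding S_def by (auto simp: vec_eq_iff)
  moreover assume "\<not> 3 \<le> card {i. d $ i \<noteq> 0}"
  ultimately have "card S = 1 \<or> card S = 2" unfolding S_def by linarith
  then consider i where "S = {i}" | i j where "S = {i, j}" "i \<noteq> j"
    by (metis card_1_singletonE card_2_iff)
  then show False
  proof cases
    case (1 i)
    then have "scale (d $ i) (\<phi> (axis i 1)) = 0"
      using linear_vec_eq_sum_axis[OF lin, of d S] assms(4) S_def by simp
    then show False
      using parent_function_axis_neq_0[OF assms(1,3)] 1 S_def by auto
  next
    case (2 i j)
    then have "scale (d $ i) (\<phi> (axis i 1)) + scale (d $ j) (\<phi> (axis j 1)) = 0"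
      using linear_vec_eq_sum_axis[OF lin, of d S] assms(4) S_def by simp
    then have "span {\<phi> (axis i 1)} = span {\<phi> (axis j 1)}"
      using 2 S_def by (intro scale_add_eq_0_imp_span_singleton_eq) auto
    then show False
      using parent_function_inj_lines[OF assms(2,3)] 2 by (auto dest: injD)
  qed
qed

end

theorem proposition4p1:
  fixes smul :: "'a::{field,finite} \<Rightarrow> 'v::ab_group_add \<Rightarrow> 'v"
    and B :: "'v set" and F :: "'v set set"
    and \<phi> :: "'a^'n::finite \<Rightarrow> 'v"
  assumes "finite_dimensional_vector_space smul B"
    and "proj_point_family smul F"
    and "card F = CARD('n)"
    and "parent_function smul F \<phi>"
  shows "(\<forall>x. proj_weight smul F x = wt_quot hamming_weight \<phi> x) \<and>
         (\<forall>x y. \<phi> x = 0 \<longrightarrow> \<phi> y = 0 \<longrightarrow> x \<noteq> y \<longrightarrow> hamming_dist x y \<ge> 3)"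
proof -
  interpret V: vector_space smul
    using assms(1) by (rule finite_dimensional_vector_space.axioms(1))
  interpret \<phi>: Vector_Spaces.linear vector_scalar_mult smul \<phi>
    using assms(4) unfolding parent_function_def by simp
  have "hamming_dist x y \<ge> 3" if "\<phi> x = 0" "\<phi> y = 0" "x \<noteq> y" for x y
  proof -
    have "3 \<le> card {i. (x - y) $ i \<noteq> 0}"
      using that by (intro V.parent_code_weight_ge_3[OF assms(2-4)]) (auto simp: \<phi>.diff)
    then show ?thesis unfolding hamming_dist_def by simp
  qed
  then show ?thesis
    using V.proj_weight_eq_wt_quot[OF assms(4)] by blast
qed

end
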